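(* Let $n,p\geq 2$ be integers and, for each $1\leq i\leq p$, let $\alpha_i=\{\alpha_{i,1},\dots,\alpha_{i,n}\}$ be a family of $n$ nonzero complex numbers (repetitions allowed). Assume that $\bigcap_{i=1}^{p}\alpha_i=\emptyset$, i.e. no complex number belongs to all of the families $\alpha_1,\dots,\alpha_p$. Then there exist matrices $A_1,\dots,A_p\in GL_n(\mathbb{C})$ having $n-1$ columns in common and such that, for every $i$, $\operatorname{spec}A_i=\alpha_i$. Moreover such a $p$-tuple is unique up to simultaneous conjugation: if $(A_1,\dots,A_p)$ and $(A_1',\dots,A_p')$ are two $p$-tuples with these properties, then there exists $u\in GL_n(\mathbb{C})$ with $A_i'=uA_iu^{-1}$ for all $i=1,\dots,p$.
   Context: Matrices $A_1,\dots,A_p$ of size $n\times n$ "have $n-1$ columns in common" if there is a set $J\subset\{1,\dots,n\}$ with $n-1$ elements such that for every $j\in J$ the $j$-th columns of $A_1,\dots,A_p$ are all equal. Here $\operatorname{spec}A_i=\alpha_i$ means that the eigenvalues of $A_i$, counted with algebraic multiplicity, are $\alpha_{i,1},\dots,\alpha_{i,n}$, i.e. $\det(X I_n-A_i)=\prod_{j=1}^{n}(X-\alpha_{i,j})$. *)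

theory Defs
  imports Complex_Main "Jordan_Normal_Form.Char_Poly"
begin

(* All index ranges are 0-based: families and matrix columns are indexed by {..<n},
   tuples of matrices by {..<p}. *)

definition GL :: "nat \<Rightarrow> complex mat set" where
  "GL n = {A \<in> carrier_mat n n. invertible_mat A}"

definition columns_in_common :: "nat \<Rightarrow> nat \<Rightarrow> (nat \<Rightarrow> complex mat) \<Rightarrow> bool" where
  "columns_in_common n p A \<longleftrightarrow>
     (\<exists>J \<subseteq> {..<n}. card J = n - 1 \<and>
        (\<forall>j\<in>J. \<forall>i<p. \<forall>i'<p. col (A i) j = col (A i') j))"

definition has_spec :: "nat \<Rightarrow> complex mat \<Rightarrow> (nat \<Rightarrow> complex) \<Rightarrow> bool" where
  "has_spec n A a \<longleftrightarrow> char_poly A = (\<Prod>j<n. [:- a j, 1:])"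

definition realizes :: "nat \<Rightarrow> nat \<Rightarrow> (nat \<Rightarrow> nat \<Rightarrow> complex) \<Rightarrow> (nat \<Rightarrow> complex mat) \<Rightarrow> bool" where
  "realizes n p \<alpha> A \<longleftrightarrow>
     (\<forall>i<p. A i \<in> GL n) \<and> columns_in_common n p A \<and> (\<forall>i<p. has_spec n (A i) (\<alpha> i))"

definition simultaneously_conjugate ::
  "nat \<Rightarrow> nat \<Rightarrow> (nat \<Rightarrow> complex mat) \<Rightarrow> (nat \<Rightarrow> complex mat) \<Rightarrow> bool" where
  "simultaneously_conjugate n p A A' \<longleftrightarrow>
     (\<exists>u \<in> GL n. \<exists>v \<in> carrier_mat n n. inverts_mat u v \<and> inverts_mat v u \<and>
        (\<forall>i<p. A' i = u * A i * v))"

end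

(* If the A_i share all columns but the r-th, they differ from A_0 by matrices b_i e_r^T.
   The rows e_r^T (A_0 - a_0) ... (A_0 - a_{k-1}), k < n, where a_0, ..., a_{n-1} are the
   eigenvalues of A_0, then transform every A_i into diag(a) plus the superdiagonal plus a first
   column; the last row closes up by Cayley-Hamilton.  That column is determined by the
   characteristic polynomial, and any monic polynomial of degree n arises, whence existence and
   uniqueness.  The rows are independent: otherwise their common kernel is A_0-stable and
   contains an eigenvector w of A_0 with w_r = 0, which is then an eigenvector of every A_i for the
   same eigenvalue. *)
theory Submission
  imports Defs "Jordan_Normal_Form.Schur_Decomposition"
begin

section \<open>Companion matrices along a fixed diagonal\<close>

text \<open>The summands are added because the column c and the diagonal meet at (0, 0). For a = 0
  this is a companion matrix; in general the characteristic polynomial is the product of all X - a_l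
  minus the sum over k of c_k times the product of the X - a_l with k < l < n. With a and c defined
  on all of nat, the matrix of size n is the leading block of the one of size n + 1.\<close>

definition diag_companion :: "nat \<Rightarrow> (nat \<Rightarrow> 'a :: comm_ring_1) \<Rightarrow> (nat \<Rightarrow> 'a) \<Rightarrow> 'a mat" where
  "diag_companion n a c = mat n n (\<lambda>(i, j).
     (if j = 0 then c i else 0) + (if j = i then a i else 0) + (if j = Suc i then 1 else 0))"

lemma diag_companion_carrier [simp]: "diag_companion n a c \<in> carrier_mat n n"
  by (simp add: diag_companion_def)

text \<open>The last row of the characteristic matrix vanishes outside columns 0 and n, so Laplace
  expansion along it has two terms. For n = 0 the two columns coincide, hence the case
  distinction.\<close>

lemma char_poly_diag_companion_Suc:
  "char_poly (diag_companion (Suc n) a c) =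
     [:- a n, 1:] * char_poly (diag_companion n a c) - [:c n:]"
proof (cases n)
  case 0
  then show ?thesis
    by (simp add: char_poly_defs diag_companion_def det_single)
next
  case (Suc m)
  define X where "X = char_poly_matrix (diag_companion (Suc n) a c)"
  have X: "X \<in> carrier_mat (Suc n) (Suc n)"
    by (simp add: X_def)
  have X_entry: "X $$ (i, j) = (if i = j then [:0, 1:] else 0) -
      [:(if j = 0 then c i else 0) + (if j = i then a i else 0) + (if j = Suc i then 1 else 0):]"
    if "i < Suc n" "j < Suc n" for i j
    using that by (auto simp: X_def char_poly_matrix_def diag_companion_def)
  define L where "L = mat_delete X n 0"
  have L: "L \<in> carrier_mat n n"
    using mat_delete_carrier[OF X] by (simp add: L_def)
  \<comment> \<open>Removing the last row and the first column turns the superdiagonal, whose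
    entries are all -1, into the diagonal, with zeros above it.\<close>
  have "det L = prod_list (diag_mat L)"
  proof (rule det_lower_triangular[OF _ L])
    show "L $$ (i, j) = 0" if "i < j" "j < n" for i j
      using that X by (simp add: L_def mat_delete_def X_entry)
  qed
  also have "\<dots> = (\<Prod>i = 0..<n. - 1)"
    unfolding prod_list_diag_prod using L X
    by (intro prod.cong) (auto simp: L_def mat_delete_def X_entry one_pCons)
  finally have det_L: "det L = (- 1) ^ n"
    by simp
  have delete_n: "mat_delete X n n = char_poly_matrix (diag_companion n a c)"
    by (rule eq_matI) (use X in \<open>auto simp: mat_delete_def X_entry char_poly_matrix_def diag_companion_def\<close>)
  have "char_poly (diag_companion (Suc n) a c) = (\<Sum>j<Suc n. X $$ (n, j) * cofactor X n j)"
    unfolding char_poly_def X_def[symmetric] by (rule laplace_expansion_row[OF X]) simp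
  also have "\<dots> = (\<Sum>j\<in>{0, n}. X $$ (n, j) * cofactor X n j)"
    by (rule sum.mono_neutral_right) (auto simp: X_entry)
  also have "\<dots> = X $$ (n, 0) * cofactor X n 0 + X $$ (n, n) * cofactor X n n"
    using Suc by simp
  \<comment> \<open>The sign of the cofactor, (-1)^n, cancels \<open>det L\<close>.\<close>
  also have "cofactor X n 0 = 1"
    using det_L by (simp add: cofactor_def L_def flip: power_add)
  also have "cofactor X n n = char_poly (diag_companion n a c)"
    by (simp add: cofactor_def delete_n char_poly_def)
  also have "X $$ (n, 0) = - [:c n:]"
    using Suc by (simp add: X_entry)
  also have "X $$ (n, n) = [:- a n, 1:]"
    using Suc by (simp add: X_entry)
  finally show ?thesis
    by simp
qed

text \<open>Evaluating the recursion at a_n kills the product and isolates c_n; the linear factor is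
  then cancelled and the induction continues with size n.\<close>

lemma char_poly_diag_companion_inject:
  fixes a c c' :: "nat \<Rightarrow> 'a :: idom"
  assumes "char_poly (diag_companion n a c) = char_poly (diag_companion n a c')" and "i < n"
  shows "c i = c' i"
  using assms
proof (induction n)
  case (Suc n)
  have eq: "[:- a n, 1:] * char_poly (diag_companion n a c) - [:c n:] =
      [:- a n, 1:] * char_poly (diag_companion n a c') - [:c' n:]"
    using Suc.prems(1) by (simp only: char_poly_diag_companion_Suc)
  have c: "c n = c' n"
    using arg_cong[OF eq, of "\<lambda>q. poly q (a n)"] by simp
  with eq have "[:- a n, 1:] * char_poly (diag_companion n a c) =
      [:- a n, 1:] * char_poly (diag_companion n a c')"
    by simp
  then have "char_poly (diag_companion n a c) = char_poly (diag_companion n a c')"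
    by (subst (asm) mult_cancel_left) simp
  with Suc.IH Suc.prems(2) c show ?case
    by (cases "i = n") auto
qed simp

text \<open>The recursion is read backwards as division with remainder by X - a_n: the remainder
  gives c_n, and the quotient is again monic, of degree one less.\<close>

lemma exists_diag_companion:
  fixes a :: "nat \<Rightarrow> 'a :: idom"
  assumes "monic q" and "degree q = n"
  shows "\<exists>c. char_poly (diag_companion n a c) = q"
  using assms
proof (induction n arbitrary: q)
  case 0
  then have "q = 1"
    by (metis monic_degree_0)
  then show ?case
    by (auto simp: char_poly_defs diag_companion_def)
next
  case (Suc n)
  define b where "b = - poly q (a n)"
  have "poly (q + [:b:]) (a n) = 0"
    by (simp add: b_def)
  then obtain r where r: "q + [:b:] = [:- a n, 1:] * r"
    by (metis poly_eq_0_iff_dvd dvdE)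
  have q: "degree (q + [:b:]) = Suc n"
    using Suc.prems by (simp add: degree_add_eq_left)
  then have "r \<noteq> 0"
    using r by force
  then have "degree r = n"
    using q unfolding r by (subst (asm) degree_mult_eq) auto
  moreover have "monic (q + [:b:])"
    using Suc.prems q by (simp add: coeff_pCons)
  then have "monic r"
    unfolding r lead_coeff_mult by simp
  ultimately obtain c where c: "char_poly (diag_companion n a c) = r"
    using Suc.IH by blast
  \<comment> \<open>Index n lies outside the matrix of size n, so the value there can still be
    chosen freely.\<close>
  have upd: "diag_companion n a (c(n := b)) = diag_companion n a c"
    by (auto simp: diag_companion_def)
  have "q = [:- a n, 1:] * r - [:b:]"
    unfolding r[symmetric] by simp
  then have "char_poly (diag_companion (Suc n) a (c(n := b))) = q"
    by (simp only: char_poly_diag_companion_Suc upd c fun_upd_same)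
  then show ?case
    by blast
qed

section \<open>Partial products of a characteristic polynomial at a matrix\<close>

text \<open>This is (A - a_0) ... (A - a_{k-1}). New factors enter on the right, so that a fixed row
  of one product times A - a_k is the same row of the next; on a column vector the newest factor
  acts first.\<close>

fun char_matrix_prod :: "'a :: field mat \<Rightarrow> (nat \<Rightarrow> 'a) \<Rightarrow> nat \<Rightarrow> 'a mat" where
  "char_matrix_prod A a 0 = 1\<^sub>m (dim_row A)"
| "char_matrix_prod A a (Suc k) = char_matrix_prod A a k * char_matrix A (a k)"

lemma char_matrix_prod_carrier [simp]:
  "A \<in> carrier_mat n n \<Longrightarrow> char_matrix_prod A a k \<in> carrier_mat n n"
  by (induction k) auto

lemma char_matrix_similar:
  assumes A: "A \<in> carrier_mat n n" and wit: "similar_mat_wit A B U V"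
  shows "char_matrix A x = U * char_matrix B x * V"
proof -
  note d = similar_mat_witD2[OF A wit]
  have "U * ((- x) \<cdot>\<^sub>m 1\<^sub>m n) * V = (- x) \<cdot>\<^sub>m (U * V)"
    using d by (simp add: mult_smult_distrib[of _ n n _ n] mult_smult_assoc_mat[of _ n n _ n])
  moreover have "U * char_matrix B x * V = U * B * V + U * ((- x) \<cdot>\<^sub>m 1\<^sub>m n) * V"
    using d by (simp add: char_matrix_def mult_add_distrib_mat[of _ n n _ n]
      add_mult_distrib_mat[of _ n n _ _ n])
  ultimately show ?thesis
    using d A by (simp add: char_matrix_def)
qed

lemma char_matrix_prod_similar:
  assumes A: "A \<in> carrier_mat n n" and wit: "similar_mat_wit A B U V"
  shows "char_matrix_prod A a k = U * char_matrix_prod B a k * V"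
proof (induction k)
  case 0
  then show ?case
    using similar_mat_witD2[OF A wit] A by simp
next
  case (Suc k)
  note d = similar_mat_witD2[OF A wit]
  define H where "H = char_matrix_prod B a k"
  define D where "D = char_matrix B (a k)"
  have H: "H \<in> carrier_mat n n" and D: "D \<in> carrier_mat n n"
    using d by (auto simp: H_def D_def)
  have "V * (U * X) = X" if "X \<in> carrier_mat n n" for X
    using that d(2,6,7) by (simp add: assoc_mult_mat[of _ n n _ n _ n, symmetric])
  then have "U * H * V * (U * D * V) = U * (H * D) * V"
    using d(6,7) H D by (simp add: assoc_mult_mat[of _ n n _ n _ n])
  then show ?case
    by (simp add: Suc char_matrix_similar[OF A wit] H_def D_def)
qed

text \<open>Each factor kills one more column: in B - a_k the columns up to k are supported in rows
  below index k, and these meet only columns of the previous product that vanish already.\<close>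

lemma char_matrix_prod_upper_triangular:
  assumes B: "B \<in> carrier_mat n n" and ut: "upper_triangular B"
    and diag: "\<And>i. i < n \<Longrightarrow> B $$ (i, i) = a i"
    and "k \<le> n" "i < n" "j < k"
  shows "char_matrix_prod B a k $$ (i, j) = 0"
  using assms(4-)
proof (induction k arbitrary: j)
  case (Suc k)
  define H where "H = char_matrix_prod B a k"
  define D where "D = char_matrix B (a k)"
  have H: "H \<in> carrier_mat n n" and D: "D \<in> carrier_mat n n"
    using B by (auto simp: H_def D_def)
  have "(H * D) $$ (i, j) = (\<Sum>l = 0..<n. H $$ (i, l) * D $$ (l, j))"
    using H D Suc.prems by (auto simp: scalar_prod_def)
  also have "\<dots> = 0"
  proof (rule sum.neutral, safe)
    fix l assume l: "l \<in> {0..<n}"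
    show "H $$ (i, l) * D $$ (l, j) = 0"
    proof (cases "l < k")
      case True
      then show ?thesis
        using Suc.IH Suc.prems by (simp add: H_def)
    next
      case False
      then have "D $$ (l, j) = 0"
        using l Suc.prems B diag upper_triangularD[OF ut, of j l]
        by (cases "l = j") (auto simp: D_def char_matrix_def less_Suc_eq)
      then show ?thesis
        by simp
    qed
  qed
  finally show ?case
    by (simp add: H_def D_def)
qed simp

text \<open>Cayley-Hamilton in factored form. The Schur decomposition makes A similar to a
  triangular matrix with the a_j on the diagonal in the given order, for which n factors kill all n
  columns.\<close>

lemma char_matrix_prod_eq_0:
  fixes A :: "'a :: conjugatable_ordered_field mat"
  assumes A: "A \<in> carrier_mat n n" and "char_poly A = (\<Prod>j<n. [:- a j, 1:])"
  shows "char_matrix_prod A a n = 0\<^sub>m n n"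
proof -
  have cp: "char_poly A = (\<Prod>b\<leftarrow>map a [0..<n]. [:- b, 1:])"
    using assms(2) by (simp add: prod.distinct_set_conv_list[of "[0..<n]", symmetric] o_def atLeast0LessThan)
  obtain B U V where schur: "schur_decomposition A (map a [0..<n]) = (B, U, V)"
    by (cases "schur_decomposition A (map a [0..<n])") auto
  have wit: "similar_mat_wit A B U V" and ut: "upper_triangular B"
    and diag: "diag_mat B = map a [0..<n]"
    using schur_decomposition[OF A cp schur] by auto
  note d = similar_mat_witD2[OF A wit]
  have "B $$ (i, i) = a i" if "i < n" for i
    using arg_cong[OF diag, of "\<lambda>xs. xs ! i"] that d by (simp add: diag_mat_def)
  then have "char_matrix_prod B a n = 0\<^sub>m n n"
    using d char_matrix_prod_upper_triangular[OF _ ut, of n a n]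
    by (intro eq_matI) (auto simp: carrier_matD[OF char_matrix_prod_carrier])
  then show ?thesis
    using d(6,7) by (simp add: char_matrix_prod_similar[OF A wit])
qed

text \<open>The factors are applied to v one at a time without leaving K; the last nonzero vector
  reached is annihilated by some A - a_l. This finds an eigenvector in a stable subspace without
  restricting A to it.\<close>

lemma eigenvector_in_invariant_subset:
  assumes A: "A \<in> carrier_mat n n" and "K \<subseteq> carrier_vec n"
    and inv: "\<And>v x. v \<in> K \<Longrightarrow> char_matrix A x *\<^sub>v v \<in> K"
    and "v \<in> K" "v \<noteq> 0\<^sub>v n" "char_matrix_prod A a k *\<^sub>v v = 0\<^sub>v n"
  shows "\<exists>w\<in>K. \<exists>x. eigenvector A w x"
  using assms(4-)
proof (induction k arbitrary: v)
  case 0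
  then show ?case
    using A \<open>K \<subseteq> carrier_vec n\<close> by auto
next
  case (Suc k)
  have v: "v \<in> carrier_vec n"
    using Suc.prems \<open>K \<subseteq> carrier_vec n\<close> by auto
  define w where "w = char_matrix A (a k) *\<^sub>v v"
  show ?case
  proof (cases "w = 0\<^sub>v n")
    case True
    then have "eigenvector A v (a k)"
      using Suc.prems v by (simp add: w_def eigenvector_char_matrix[OF A])
    then show ?thesis
      using Suc.prems by blast
  next
    case False
    have "char_matrix_prod A a k *\<^sub>v w = 0\<^sub>v n"
      using Suc.prems v A
      by (simp add: w_def assoc_mult_mat_vec[symmetric, of _ n n _ n])
    moreover have "w \<in> K"
      unfolding w_def by (rule inv[OF Suc.prems(1)])
    ultimately show ?thesis
      using Suc.IH[of w] False by blast
  qed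
qed

section \<open>The normal form\<close>

text \<open>Krylov matrix of the row vector e_r^T, formed with the Newton products in place of the
  powers of A.\<close>

definition krylov_mat :: "complex mat \<Rightarrow> (nat \<Rightarrow> complex) \<Rightarrow> nat \<Rightarrow> complex mat" where
  "krylov_mat A a r = mat (dim_row A) (dim_row A) (\<lambda>(k, j). char_matrix_prod A a k $$ (r, j))"

lemma krylov_mat_carrier [simp]: "A \<in> carrier_mat n n \<Longrightarrow> krylov_mat A a r \<in> carrier_mat n n"
  by (simp add: krylov_mat_def)

text \<open>Rows p_k of P satisfy p_k A = p_{k+1} + a_k p_k, and M - A = b e_r^T = b p_0 adds the
  column P b. No inverse of P appears, as the case M = A serves to prove that P is
  invertible.\<close>

lemma krylov_mat_intertwines:
  assumes A: "A \<in> carrier_mat n n" and "r < n" and spec: "has_spec n A a"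
    and M: "M \<in> carrier_mat n n"
    and cols: "\<And>j. j < n \<Longrightarrow> j \<noteq> r \<Longrightarrow> col M j = col A j"
  shows "\<exists>c. krylov_mat A a r * M = diag_companion n a c * krylov_mat A a r"
proof -
  define P where "P = krylov_mat A a r"
  define G where "G = char_matrix_prod A a"
  have P: "P \<in> carrier_mat n n" and G: "\<And>k. G k \<in> carrier_mat n n"
    using A by (auto simp: P_def G_def)
  have P_entry: "P $$ (k, j) = G k $$ (r, j)" if "k < n" "j < n" for k j
    using that A by (simp add: P_def G_def krylov_mat_def)
  have G_n: "G n = 0\<^sub>m n n"
    using char_matrix_prod_eq_0[OF A] spec by (simp add: G_def has_spec_def)
  have PA: "(P * A) $$ (k, j) = G (Suc k) $$ (r, j) + a k * G k $$ (r, j)"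
    if kj: "k < n" "j < n" for k j
  proof -
    have "row P k = row (G k) r"
      using kj \<open>r < n\<close> P G[of k] P_entry by (intro eq_vecI) auto
    then have PG: "(P * A) $$ (k, j) = (G k * A) $$ (r, j)"
      using kj \<open>r < n\<close> P A G[of k] by simp
    have "G (Suc k) = G k * char_matrix A (a k)"
      by (simp add: G_def)
    also have "\<dots> = G k * A + (- a k) \<cdot>\<^sub>m G k"
      using A G[of k] by (simp add: char_matrix_def mult_add_distrib_mat[of _ n n _ n]
        mult_smult_distrib[of _ n n _ n])
    finally show ?thesis
      using kj \<open>r < n\<close> A G[of k] PG by simp
  qed
  \<comment> \<open>M and A differ only in column r, so this is the vector P b for M - A = b
    e_r^T.\<close>
  define c where "c k = (P * M) $$ (k, r) - (P * A) $$ (k, r)" for k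
  have PM: "(P * M) $$ (k, j) = (P * A) $$ (k, j) + (if j = r then c k else 0)"
    if "k < n" "j < n" for k j
    using that cols[of j] P A M by (simp add: c_def)
  have "P * M = diag_companion n a c * P"
  proof (rule eq_matI)
    fix k j assume "k < dim_row (diag_companion n a c * P)" "j < dim_col (diag_companion n a c * P)"
    then have kj: "k < n" "j < n"
      using P by (auto simp: diag_companion_def)
    have "(diag_companion n a c * P) $$ (k, j) =
        (\<Sum>l = 0..<n. diag_companion n a c $$ (k, l) * P $$ (l, j))"
      using kj P by (simp add: scalar_prod_def diag_companion_def)
    also have "\<dots> = (\<Sum>l = 0..<n. (if l = 0 then c k * P $$ (l, j) else 0)
        + (if l = k then a k * P $$ (l, j) else 0) + (if l = Suc k then P $$ (l, j) else 0))"
      by (rule sum.cong) (use kj in \<open>auto simp: diag_companion_def algebra_simps\<close>)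
    also have "\<dots> = c k * P $$ (0, j) + a k * P $$ (k, j) + (if Suc k < n then P $$ (Suc k, j) else 0)"
      using kj by (simp add: sum.distrib)
    \<comment> \<open>For k = n - 1 there is no next row; the missing term is a row of
      \<open>G n\<close>, which is zero by Cayley-Hamilton.\<close>
    also have "(if Suc k < n then P $$ (Suc k, j) else 0) = G (Suc k) $$ (r, j)"
    proof (cases "Suc k < n")
      case False
      with kj have "Suc k = n" by simp
      then show ?thesis
        using kj \<open>r < n\<close> by (simp add: G_n del: char_matrix_prod.simps)
    qed (use kj P_entry in simp)
    also have "P $$ (0, j) = (if j = r then 1 else 0)"
      using kj \<open>r < n\<close> A P_entry[of 0 j] by (auto simp: G_def)
    also have "P $$ (k, j) = G k $$ (r, j)"
      using kj by (rule P_entry)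
    finally show "(P * M) $$ (k, j) = (diag_companion n a c * P) $$ (k, j)"
      using kj by (simp add: PM PA)
  qed (use P M in \<open>auto simp: diag_companion_def\<close>)
  then show ?thesis
    by (auto simp: P_def)
qed

section \<open>Independence of the Krylov rows\<close>

lemma mult_mat_vec_eq_if_cols_eq:
  fixes A M :: "'a :: comm_ring_1 mat"
  assumes A: "A \<in> carrier_mat n n" and M: "M \<in> carrier_mat n n"
    and cols: "\<And>j. j < n \<Longrightarrow> j \<noteq> r \<Longrightarrow> col M j = col A j"
    and v: "v \<in> carrier_vec n" "v $ r = 0"
  shows "M *\<^sub>v v = A *\<^sub>v v"
proof (rule eq_vecI)
  fix i assume "i < dim_vec (A *\<^sub>v v)"
  then have i: "i < n" using A by simp
  have "M $$ (i, j) * v $ j = A $$ (i, j) * v $ j" if "j < n" for j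
    using arg_cong[OF cols[of j], of "\<lambda>w. w $ i"] that i A M v by (cases "j = r") auto
  then show "(M *\<^sub>v v) $ i = (A *\<^sub>v v) $ i"
    using i A M v by (auto simp: scalar_prod_def intro!: sum.cong)
qed (use A M in auto)

text \<open>By the intertwining relation the kernel of P is stable under A, so if nonzero it
  contains an eigenvector of A; row 0 of P, which is e_r^T, forces the coordinate r of that
  eigenvector to vanish.\<close>

lemma krylov_mat_det_nonzero:
  assumes A: "A \<in> carrier_mat n n" and "r < n" and spec: "has_spec n A a"
    and no_common: "\<And>w x. eigenvector A w x \<Longrightarrow> w $ r \<noteq> 0"
  shows "det (krylov_mat A a r) \<noteq> 0"
proof
  define P where "P = krylov_mat A a r"
  have P: "P \<in> carrier_mat n n"
    using A by (simp add: P_def)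
  assume "det (krylov_mat A a r) = 0"
  then obtain v where v: "v \<in> carrier_vec n" "v \<noteq> 0\<^sub>v n" "P *\<^sub>v v = 0\<^sub>v n"
    using det_0_iff_vec_prod_zero[OF P] by (auto simp: P_def)
  define K where "K = {w \<in> carrier_vec n. P *\<^sub>v w = 0\<^sub>v n}"
  obtain c where PA: "P * A = diag_companion n a c * P"
    using krylov_mat_intertwines[OF A \<open>r < n\<close> spec A] by (auto simp: P_def)
  have "char_matrix A x *\<^sub>v w \<in> K" if "w \<in> K" for w x
  proof -
    have w: "w \<in> carrier_vec n" "P *\<^sub>v w = 0\<^sub>v n"
      using that by (auto simp: K_def)
    have "P *\<^sub>v (A *\<^sub>v w) = diag_companion n a c *\<^sub>v (P *\<^sub>v w)"
      using w P A PA by (metis assoc_mult_mat_vec diag_companion_carrier)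
    then have PAw: "P *\<^sub>v (A *\<^sub>v w) = 0\<^sub>v n"
      using w by (auto simp: diag_companion_def)
    have "char_matrix A x *\<^sub>v w = A *\<^sub>v w + (- x) \<cdot>\<^sub>v w"
      by (rule eq_vecI) (use A w in \<open>auto simp: char_matrix_def add_scalar_prod_distrib[of _ n]\<close>)
    also have "P *\<^sub>v \<dots> = P *\<^sub>v (A *\<^sub>v w) + (- x) \<cdot>\<^sub>v (P *\<^sub>v w)"
      using P A w by (simp add: mult_add_distrib_mat_vec[of _ n n] mult_mat_vec[of _ n n])
    also have "\<dots> = 0\<^sub>v n"
      by (intro eq_vecI) (simp_all add: PAw w)
    finally show ?thesis
      using A w by (simp add: K_def mult_mat_vec_carrier[of _ n n])
  qed
  \<comment> \<open>The full product is zero, so any nonzero vector of the kernel can start the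
    search for an eigenvector.\<close>
  moreover have "char_matrix_prod A a n *\<^sub>v v = 0\<^sub>v n"
    using char_matrix_prod_eq_0[OF A spec[unfolded has_spec_def]] v(1)
    by (intro eq_vecI) auto
  ultimately obtain w x where w: "w \<in> K" "eigenvector A w x"
    using eigenvector_in_invariant_subset[OF A, of K v a n] v by (auto simp: K_def)
  have "0 < n" using \<open>r < n\<close> by simp
  have "row P 0 = unit_vec n r"
    using A P \<open>0 < n\<close> \<open>r < n\<close> by (intro eq_vecI) (auto simp: P_def krylov_mat_def)
  moreover have "w \<in> carrier_vec n"
    using w by (simp add: K_def)
  ultimately have "w $ r = (P *\<^sub>v w) $ 0"
    using P \<open>0 < n\<close> \<open>r < n\<close> by simp
  also have "\<dots> = 0"
    using w \<open>0 < n\<close> by (simp add: K_def)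
  finally show False
    using no_common[OF w(2)] by simp
qed

section \<open>Reduction of a realizing tuple to normal form\<close>

lemma det_nonzero_obtain_inverse:
  fixes P :: "'a :: field mat"
  assumes P: "P \<in> carrier_mat n n" and "det P \<noteq> 0"
  obtains Q where "Q \<in> carrier_mat n n" "P * Q = 1\<^sub>m n" "Q * P = 1\<^sub>m n"
  \<comment> \<open>\<open>undefined\<close> fills the extension slot of the ring record, whose
    value is irrelevant.\<close>
  using det_non_zero_imp_unit[OF assms, of undefined] by (auto simp: Units_def ring_mat_def)

lemma GL_I:
  assumes "P \<in> carrier_mat n n" "Q \<in> carrier_mat n n" "P * Q = 1\<^sub>m n" "Q * P = 1\<^sub>m n"
  shows "P \<in> GL n"
  using assms by (auto simp: GL_def invertible_mat_def inverts_mat_def intro!: exI[of _ Q])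

lemma has_spec_eigenvalue:
  assumes "A \<in> carrier_mat n n" "has_spec n A a" "eigenvalue A x"
  shows "x \<in> a ` {..<n}"
  using assms by (auto simp: has_spec_def eigenvalue_root_char_poly poly_prod)

lemma realizes_common_columnsE:
  assumes "realizes n p \<alpha> A" "0 < n"
  obtains r where "r < n"
    "\<And>i i' j. i < p \<Longrightarrow> i' < p \<Longrightarrow> j < n \<Longrightarrow> j \<noteq> r \<Longrightarrow> col (A i) j = col (A i') j"
proof -
  obtain J where J: "J \<subseteq> {..<n}" "card J = n - 1"
    and cols: "\<And>i i' j. j \<in> J \<Longrightarrow> i < p \<Longrightarrow> i' < p \<Longrightarrow> col (A i) j = col (A i') j"
    using assms(1) unfolding realizes_def columns_in_common_def by blast
  have "card ({..<n} - J) = 1"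
    using J \<open>0 < n\<close> by (simp add: card_Diff_subset finite_subset)
  then obtain r where "{..<n} - J = {r}"
    by (auto simp: card_1_singleton_iff)
  then show ?thesis
    using that[of r] cols by blast
qed

text \<open>One pair P, Q serves all i, and the c_i are fixed before the tuple is considered. Any
  two realizing tuples are therefore conjugate to the same tuple.\<close>

lemma realizes_similar_diag_companion:
  assumes "0 < n" "0 < p"
    and disjoint: "(\<Inter>i\<in>{..<p}. \<alpha> i ` {..<n}) = {}"
    and A: "realizes n p \<alpha> A"
    and c: "\<And>i. i < p \<Longrightarrow> has_spec n (diag_companion n (\<alpha> 0) (c i)) (\<alpha> i)"
  shows "\<exists>P Q. P \<in> carrier_mat n n \<and> Q \<in> carrier_mat n n \<and> P * Q = 1\<^sub>m n \<and> Q * P = 1\<^sub>m n \<and>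
    (\<forall>i<p. A i = Q * diag_companion n (\<alpha> 0) (c i) * P)"
proof -
  obtain r where r: "r < n"
    and cols: "\<And>i i' j. i < p \<Longrightarrow> i' < p \<Longrightarrow> j < n \<Longrightarrow> j \<noteq> r \<Longrightarrow> col (A i) j = col (A i') j"
    using realizes_common_columnsE[OF A \<open>0 < n\<close>] by blast
  have Ai: "A i \<in> carrier_mat n n" and spec: "has_spec n (A i) (\<alpha> i)" if "i < p" for i
    using A that by (auto simp: realizes_def GL_def)
  define P where "P = krylov_mat (A 0) (\<alpha> 0) r"
  have P: "P \<in> carrier_mat n n"
    using Ai[OF \<open>0 < p\<close>] by (simp add: P_def)
  \<comment> \<open>With w_r = 0 the product A_i w involves only the shared columns, so x would be
    an eigenvalue of every A_i and lie in all families.\<close>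
  have "w $ r \<noteq> 0" if w: "eigenvector (A 0) w x" for w x
  proof
    assume "w $ r = 0"
    have "x \<in> \<alpha> i ` {..<n}" if i: "i < p" for i
    proof -
      have "A i *\<^sub>v w = A 0 *\<^sub>v w"
        using w Ai[OF \<open>0 < p\<close>] \<open>w $ r = 0\<close>
        by (intro mult_mat_vec_eq_if_cols_eq[OF Ai[OF \<open>0 < p\<close>] Ai[OF i] cols[OF i \<open>0 < p\<close>]])
          (auto simp: eigenvector_def)
      then have "eigenvector (A i) w x"
        using w Ai[OF \<open>0 < p\<close>] Ai[OF i] by (auto simp: eigenvector_def)
      then show ?thesis
        using has_spec_eigenvalue[OF Ai[OF i] spec[OF i]] by (auto simp: eigenvalue_def)
    qed
    with disjoint show False
      by blast
  qed
  then have "det P \<noteq> 0"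
    unfolding P_def using krylov_mat_det_nonzero[OF Ai[OF \<open>0 < p\<close>] r spec[OF \<open>0 < p\<close>]] by blast
  then obtain Q where Q: "Q \<in> carrier_mat n n" "P * Q = 1\<^sub>m n" "Q * P = 1\<^sub>m n"
    using det_nonzero_obtain_inverse[OF P] by blast
  have "A i = Q * diag_companion n (\<alpha> 0) (c i) * P" if i: "i < p" for i
  proof -
    obtain d where d: "P * A i = diag_companion n (\<alpha> 0) d * P"
      using krylov_mat_intertwines[OF Ai[OF \<open>0 < p\<close>] r spec[OF \<open>0 < p\<close>] Ai[OF i] cols[OF i \<open>0 < p\<close>]]
      by (auto simp: P_def)
    have "A i = Q * P * A i"
      using Q Ai[OF i] by simp
    also have "\<dots> = Q * diag_companion n (\<alpha> 0) d * P"
      using d P Q(1) Ai[OF i] by (simp add: assoc_mult_mat[of _ n n _ n _ n])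
    finally have A_d: "A i = Q * diag_companion n (\<alpha> 0) d * P" .
    then have "similar_mat (A i) (diag_companion n (\<alpha> 0) d)"
      using P Q Ai[OF i] unfolding similar_mat_def
      by (intro exI[of _ Q] exI[of _ P]) (auto simp: similar_mat_wit_def Let_def)
    \<comment> \<open>The column d comes from the tuple; having the same characteristic polynomial,
      it must agree with the prescribed \<open>c i\<close>.\<close>
    then have "char_poly (diag_companion n (\<alpha> 0) d) = char_poly (diag_companion n (\<alpha> 0) (c i))"
      using char_poly_similar c[OF i] spec[OF i] by (metis has_spec_def)
    then have "d k = c i k" if "k < n" for k
      using char_poly_diag_companion_inject that by blast
    then have "diag_companion n (\<alpha> 0) d = diag_companion n (\<alpha> 0) (c i)"
      by (auto simp: diag_companion_def)
    with A_d show ?thesis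
      by simp
  qed
  with P Q show ?thesis
    by blast
qed

section \<open>Existence, and conjugacy through the normal form\<close>

lemma diag_companion_realizes:
  assumes "0 < n" and nonzero: "\<And>i j. i < p \<Longrightarrow> j < n \<Longrightarrow> \<alpha> i j \<noteq> 0"
    and c: "\<And>i. i < p \<Longrightarrow> has_spec n (diag_companion n a (c i)) (\<alpha> i)"
  shows "realizes n p \<alpha> (\<lambda>i. diag_companion n a (c i))"
  unfolding realizes_def
proof (intro conjI allI impI)
  fix i assume i: "i < p"
  let ?C = "diag_companion n a (c i)"
  have "\<not> eigenvalue ?C 0"
    using has_spec_eigenvalue[OF _ c[OF i]] nonzero[OF i] by force
  \<comment> \<open>At the value 0 the eigenvalue criterion becomes a statement about the
    determinant of the matrix itself.\<close>
  moreover have "char_matrix ?C 0 = ?C"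
    by (rule eq_matI) (auto simp: char_matrix_def diag_companion_def)
  ultimately have "det ?C \<noteq> 0"
    using eigenvalue_det[of ?C n 0] by simp
  then show "?C \<in> GL n"
    using det_nonzero_obtain_inverse GL_I diag_companion_carrier by metis
next
  show "columns_in_common n p (\<lambda>i. diag_companion n a (c i))"
    unfolding columns_in_common_def
    \<comment> \<open>Only column 0 depends on i.\<close>
    by (rule exI[of _ "{1..<n}"]) (auto simp: diag_companion_def col_def)
qed (use c in blast)

theorem mainTheorem1:
  fixes n p :: nat and \<alpha> :: "nat \<Rightarrow> nat \<Rightarrow> complex"
  assumes "n \<ge> 2" and "p \<ge> 2"
    and "\<forall>i<p. \<forall>j<n. \<alpha> i j \<noteq> 0"
    and "(\<Inter>i\<in>{..<p}. \<alpha> i ` {..<n}) = {}"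
  shows "(\<exists>A. realizes n p \<alpha> A) \<and>
    (\<forall>A A'. realizes n p \<alpha> A \<longrightarrow> realizes n p \<alpha> A' \<longrightarrow> simultaneously_conjugate n p A A')"
proof -
  have pos: "0 < n" "0 < p"
    using assms by auto
  \<comment> \<open>The diagonal is \<open>\<alpha> 0\<close> for every i, so that the resulting
    matrices share their other columns; the spectrum is adjusted by c alone.\<close>
  have "\<exists>c. has_spec n (diag_companion n (\<alpha> 0) c) (\<alpha> i)" for i
  proof -
    have "monic (\<Prod>j<n. [:- \<alpha> i j, 1:])"
      by (rule monic_prod) simp
    moreover have "degree (\<Prod>j<n. [:- \<alpha> i j, 1:]) = n"
      by (subst degree_prod_eq_sum_degree) auto
    ultimately show ?thesis
      unfolding has_spec_def by (intro exists_diag_companion) simp_all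
  qed
  then obtain c where c: "\<And>i. has_spec n (diag_companion n (\<alpha> 0) (c i)) (\<alpha> i)"
    by metis
  have "realizes n p \<alpha> (\<lambda>i. diag_companion n (\<alpha> 0) (c i))"
    using diag_companion_realizes pos assms(3) c by blast
  moreover have "simultaneously_conjugate n p A A'"
    if A: "realizes n p \<alpha> A" and A': "realizes n p \<alpha> A'" for A A'
  proof -
    obtain P Q where P: "P \<in> carrier_mat n n" and Q: "Q \<in> carrier_mat n n"
      and inv: "P * Q = 1\<^sub>m n" "Q * P = 1\<^sub>m n"
      and AP: "\<And>i. i < p \<Longrightarrow> A i = Q * diag_companion n (\<alpha> 0) (c i) * P"
      using realizes_similar_diag_companion[OF pos assms(4) A c] by blast
    obtain P' Q' where P': "P' \<in> carrier_mat n n" and Q': "Q' \<in> carrier_mat n n"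
      and inv': "P' * Q' = 1\<^sub>m n" "Q' * P' = 1\<^sub>m n"
      and AP': "\<And>i. i < p \<Longrightarrow> A' i = Q' * diag_companion n (\<alpha> 0) (c i) * P'"
      using realizes_similar_diag_companion[OF pos assms(4) A' c] by blast
    have cancel: "P * (Q * X) = X" "Q * (P * X) = X" "P' * (Q' * X) = X" "Q' * (P' * X) = X"
      if "X \<in> carrier_mat n n" for X
      using that P Q P' Q' inv inv' by (simp_all add: assoc_mult_mat[of _ n n _ n _ n, symmetric])
    \<comment> \<open>P carries the first tuple to the normal form, and Q' carries the normal form
      to the second tuple.\<close>
    define u where "u = Q' * P"
    define v where "v = Q * P'"
    have uv: "u \<in> carrier_mat n n" "v \<in> carrier_mat n n" "u * v = 1\<^sub>m n" "v * u = 1\<^sub>m n"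
      using P Q P' Q' inv inv' by (simp_all add: u_def v_def assoc_mult_mat[of _ n n _ n _ n] cancel)
    have "u * (Q * X * P) * v = Q' * X * P'" if "X \<in> carrier_mat n n" for X
      using that P Q P' Q'
      by (simp add: u_def v_def assoc_mult_mat[of _ n n _ n _ n] cancel)
    then have "A' i = u * A i * v" if "i < p" for i
      using that by (simp add: AP AP')
    with uv show ?thesis
      unfolding simultaneously_conjugate_def
      by (intro bexI[of _ u] bexI[of _ v]) (auto simp: inverts_mat_def intro: GL_I)
  qed
  ultimately show ?thesis
    by blast
qed

end
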